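(* The endomorphisms $\sigma_*$ and $\tau_*$ of $\mathfrak{spin}(8)$ generate (under composition) a copy of the permutation group $S_3$ of three symbols.
   Context: $Cl_8$ is the real Clifford algebra generated by the standard basis vectors $e_1,\dots,e_8$ of $\mathbb{R}^8$ with $e_je_k=-e_ke_j$ for $j\ne k$ and $e_j^2=-1$. $\mathfrak{spin}(8)\subset Cl_8$ is the real span of $e_{ij}:=e_ie_j$, $1\le i<j\le 8$, with the commutator bracket. The linear endomorphism $\tau_*$ of $\mathfrak{spin}(8)$ is given by $\tau_*(e_{ij})=\frac12 t_{ij}$ where $t_{12}=e_{12}+e_{34}+e_{56}+e_{78}$, $t_{13}=e_{13}-e_{24}+e_{57}-e_{68}$, $t_{14}=e_{14}+e_{23}-e_{58}-e_{67}$, $t_{15}=e_{15}-e_{26}-e_{37}+e_{48}$, $t_{16}=e_{16}+e_{25}+e_{38}+e_{47}$, $t_{17}=e_{17}-e_{28}+e_{35}-e_{46}$, $t_{18}=e_{18}+e_{27}-e_{36}-e_{45}$, $t_{23}=e_{14}+e_{23}+e_{58}+e_{67}$, $t_{24}=-e_{13}+e_{24}+e_{57}-e_{68}$, $t_{25}=e_{16}+e_{25}-e_{38}-e_{47}$, $t_{26}=-e_{15}+e_{26}-e_{37}+e_{48}$, $t_{27}=e_{18}+e_{27}+e_{36}+e_{45}$, $t_{28}=-e_{17}+e_{28}+e_{35}-e_{46}$, $t_{34}=e_{12}+e_{34}-e_{56}-e_{78}$, $t_{35}=e_{17}+e_{28}+e_{35}+e_{46}$, $t_{36}=-e_{18}+e_{27}+e_{36}-e_{45}$,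 $t_{37}=-e_{15}-e_{26}+e_{37}+e_{48}$, $t_{38}=e_{16}-e_{25}+e_{38}-e_{47}$, $t_{45}=-e_{18}+e_{27}-e_{36}+e_{45}$, $t_{46}=-e_{17}-e_{28}+e_{35}+e_{46}$, $t_{47}=e_{16}-e_{25}-e_{38}+e_{47}$, $t_{48}=e_{15}+e_{26}+e_{37}+e_{48}$, $t_{56}=e_{12}-e_{34}+e_{56}-e_{78}$, $t_{57}=e_{13}+e_{24}+e_{57}+e_{68}$, $t_{58}=-e_{14}+e_{23}+e_{58}-e_{67}$, $t_{67}=-e_{14}+e_{23}-e_{58}+e_{67}$, $t_{68}=-e_{13}-e_{24}+e_{57}+e_{68}$, $t_{78}=e_{12}-e_{34}-e_{56}+e_{78}$. The linear endomorphism $\sigma_*$ of $\mathfrak{spin}(8)$ is given by $\sigma_*(e_{1k})=-\frac12 t_{1k}$ for $2\le k\le 8$ and $\sigma_*(e_{ij})=\frac12 t_{ij}$ for $2\le i<j\le 8$. *)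

theory Defs
  imports Complex_Main "HOL-Algebra.Sym_Groups"
begin

text \<open>
  The Clifford algebra is modelled on its basis of blades: for a subset
  \<open>A = {i\<^sub>1 < \<dots> < i\<^sub>k}\<close> of \<open>{1..8}\<close> the blade of \<open>A\<close> is the product
  \<open>e i\<^sub>1 * \<dots> * e i\<^sub>k\<close>, and an element is the function giving its real coefficients.
  The lemma \<open>cl8_universal\<close> shows that this is the algebra presented by the Clifford relations.
\<close>

typedef cl8 = "{x :: nat set \<Rightarrow> real. \<forall>A. \<not> A \<subseteq> {1..8} \<longrightarrow> x A = 0}"
  morphisms coeff8 Abs_cl8
  by (rule exI[of _ "\<lambda>_. 0"]) simp

setup_lifting type_definition_cl8

lemma coeff8_outside: "\<not> A \<subseteq> {1..8} \<Longrightarrow> coeff8 x A = 0"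
  using coeff8[of x] by blast

lemma cl8_eqI: "(\<And>A. A \<subseteq> {1..8} \<Longrightarrow> coeff8 x A = coeff8 y A) \<Longrightarrow> x = y"
  by (metis coeff8_inject coeff8_outside ext)

definition sdiff :: "nat set \<Rightarrow> nat set \<Rightarrow> nat set" where
  "sdiff A B = (A - B) \<union> (B - A)"

lemma sdiff_assoc: "sdiff (sdiff A B) C = sdiff A (sdiff B C)"
  and sdiff_cancel [simp]: "sdiff A (sdiff A B) = B"
  and sdiff_self [simp]: "sdiff A A = {}"
  and sdiff_empty [simp]: "sdiff A {} = A" "sdiff {} A = A"
  by (auto simp: sdiff_def)

lemma sdiff_commute: "sdiff A B = sdiff B A"
  by (auto simp: sdiff_def)

lemma sdiff_subset: "A \<subseteq> S \<Longrightarrow> B \<subseteq> S \<Longrightarrow> sdiff A B \<subseteq> S"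
  by (auto simp: sdiff_def)

lemma sdiff_outside: "\<not> C \<subseteq> S \<Longrightarrow> A \<subseteq> S \<Longrightarrow> \<not> sdiff A C \<subseteq> S"
  by (auto simp: sdiff_def)

lemma sdiff_eq_iff: "sdiff A B = C \<longleftrightarrow> B = sdiff A C"
  by (metis sdiff_cancel)

text \<open>
  Sign in \<open>blade A * blade B = blade_sign A B \<cdot> blade (sdiff A B)\<close>: one factor \<open>-1\<close> for every
  transposition of \<open>a\<close> past some \<open>b < a\<close>, and one for every \<open>a = b\<close>, since \<open>e a * e a = -1\<close>.
\<close>

definition blade_sign :: "nat set \<Rightarrow> nat set \<Rightarrow> real" where
  "blade_sign A B = (\<Prod>a\<in>A. \<Prod>b\<in>B. if b \<le> a then -1 else 1)"

lemma prod_sdiff: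
  fixes f :: "nat \<Rightarrow> real"
  assumes "finite A" "finite B" "\<And>x. f x * f x = 1"
  shows "prod f (sdiff A B) = prod f A * prod f B"
proof -
  have A: "prod f A = prod f (A - B) * prod f (A \<inter> B)"
    using assms(1) by (metis inf_commute mult.commute prod.Int_Diff)
  have B: "prod f B = prod f (B - A) * prod f (A \<inter> B)"
    using assms(2) by (metis inf_commute mult.commute prod.Int_Diff)
  have "prod f (A \<inter> B) * prod f (A \<inter> B) = 1"
    by (simp add: assms(3) flip: prod.distrib)
  moreover have "prod f (sdiff A B) = prod f (A - B) * prod f (B - A)"
    unfolding sdiff_def using assms by (intro prod.union_disjoint) auto
  ultimately show ?thesis
    unfolding A B by (simp add: algebra_simps)
qed

lemma blade_sign_sdiff_left:
  assumes "finite A" "finite B"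
  shows "blade_sign (sdiff A B) C = blade_sign A C * blade_sign B C"
  unfolding blade_sign_def using assms
  by (intro prod_sdiff) (auto simp flip: prod.distrib intro!: prod.neutral)

lemma blade_sign_sdiff_right:
  assumes "finite B" "finite C"
  shows "blade_sign A (sdiff B C) = blade_sign A B * blade_sign A C"
proof -
  have "(\<Prod>b\<in>sdiff B C. if b \<le> a then -1 else 1 :: real)
      = (\<Prod>b\<in>B. if b \<le> a then -1 else 1) * (\<Prod>b\<in>C. if b \<le> a then -1 else 1)" for a
    using assms by (intro prod_sdiff) auto
  then show ?thesis
    by (simp add: blade_sign_def prod.distrib)
qed

lemma blade_sign_empty [simp]: "blade_sign {} A = 1" "blade_sign A {} = 1"
  by (auto simp: blade_sign_def)

lemma blade_sign_cocycle:
  assumes "finite A" "finite B" "finite C"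
  shows "blade_sign A B * blade_sign (sdiff A B) C = blade_sign A (sdiff B C) * blade_sign B C"
  using assms by (simp add: blade_sign_sdiff_left blade_sign_sdiff_right)

instantiation cl8 :: real_algebra_1
begin

lift_definition zero_cl8 :: cl8 is "\<lambda>_. 0" by simp
lift_definition one_cl8 :: cl8 is "\<lambda>A. if A = {} then 1 else 0" by auto
lift_definition plus_cl8 :: "cl8 \<Rightarrow> cl8 \<Rightarrow> cl8" is "\<lambda>x y A. x A + y A" by simp
lift_definition minus_cl8 :: "cl8 \<Rightarrow> cl8 \<Rightarrow> cl8" is "\<lambda>x y A. x A - y A" by simp
lift_definition uminus_cl8 :: "cl8 \<Rightarrow> cl8" is "\<lambda>x A. - x A" by simp
lift_definition scaleR_cl8 :: "real \<Rightarrow> cl8 \<Rightarrow> cl8" is "\<lambda>c x A. c * x A" by simp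
lift_definition times_cl8 :: "cl8 \<Rightarrow> cl8 \<Rightarrow> cl8" is
  "\<lambda>x y C. \<Sum>A\<in>Pow {1..8}. blade_sign A (sdiff A C) * x A * y (sdiff A C)"
  by (intro allI impI sum.neutral) (use sdiff_outside in auto)

instance
proof
  fix x y z :: cl8 and a b :: real
  show "x + y + z = x + (y + z)" by transfer auto
  show "x + y = y + x" by transfer auto
  show "0 + x = x" by transfer auto
  show "- x + x = 0" by transfer auto
  show "x - y = x + - y" by transfer auto
  show "a *\<^sub>R (x + y) = a *\<^sub>R x + a *\<^sub>R y" by transfer (auto simp: algebra_simps)
  show "(a + b) *\<^sub>R x = a *\<^sub>R x + b *\<^sub>R x" by transfer (auto simp: algebra_simps)
  show "a *\<^sub>R b *\<^sub>R x = (a * b) *\<^sub>R x" by transfer (auto simp: algebra_simps)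
  show "1 *\<^sub>R x = x" by transfer auto
  show "(x + y) * z = x * z + y * z"
    by transfer (auto simp: algebra_simps sum.distrib)
  show "x * (y + z) = x * y + x * z"
    by transfer (auto simp: algebra_simps sum.distrib)
  show "a *\<^sub>R x * y = a *\<^sub>R (x * y)"
    by transfer (auto simp: algebra_simps sum_distrib_left)
  show "x * a *\<^sub>R y = a *\<^sub>R (x * y)"
    by transfer (auto simp: algebra_simps sum_distrib_left)
  show "(0::cl8) \<noteq> 1" by transfer (metis zero_neq_one)
  show "1 * x = x"
  proof (rule cl8_eqI)
    fix C :: "nat set" assume "C \<subseteq> {1..8}"
    have "coeff8 (1 * x) C = (\<Sum>A\<in>Pow {1..8::nat}. if A = {} then coeff8 x C else 0)"
      unfolding times_cl8.rep_eq one_cl8.rep_eq by (intro sum.cong) auto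
    then show "coeff8 (1 * x) C = coeff8 x C" by simp
  qed
  show "x * 1 = x"
  proof (rule cl8_eqI)
    fix C :: "nat set" assume C: "C \<subseteq> {1..8}"
    have eq: "sdiff A C = {} \<longleftrightarrow> A = C" for A by (auto simp: sdiff_def)
    have "coeff8 (x * 1) C = (\<Sum>A\<in>Pow {1..8}. if A = C then coeff8 x C else 0)"
      unfolding times_cl8.rep_eq one_cl8.rep_eq by (intro sum.cong) (auto simp: eq)
    then show "coeff8 (x * 1) C = coeff8 x C" using C by simp
  qed
  show "x * y * z = x * (y * z)"
  proof (rule cl8_eqI)
    fix D :: "nat set" assume D: "D \<subseteq> {1..8}"
    let ?P = "Pow {1..8::nat}"
    have fin: "A \<in> ?P \<Longrightarrow> finite A" for A by (auto intro: finite_subset)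
    have "coeff8 (x * y * z) D = (\<Sum>C\<in>?P. blade_sign C (sdiff C D) *
        (\<Sum>A\<in>?P. blade_sign A (sdiff A C) * coeff8 x A * coeff8 y (sdiff A C)) *
        coeff8 z (sdiff C D))"
      by (simp add: times_cl8.rep_eq)
    also have "\<dots> = (\<Sum>A\<in>?P. \<Sum>C\<in>?P. blade_sign A (sdiff A C) * blade_sign C (sdiff C D) *
        (coeff8 x A * coeff8 y (sdiff A C) * coeff8 z (sdiff C D)))"
      by (subst sum.swap) (simp add: sum_distrib_left sum_distrib_right mult_ac)
    also have "\<dots> = (\<Sum>A\<in>?P. \<Sum>B\<in>?P. blade_sign A (sdiff A D) * blade_sign B (sdiff B (sdiff A D)) *
        (coeff8 x A * coeff8 y B * coeff8 z (sdiff B (sdiff A D))))"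
    proof (rule sum.cong[OF refl])
      fix A assume A: "A \<in> ?P"
      show "(\<Sum>C\<in>?P. blade_sign A (sdiff A C) * blade_sign C (sdiff C D) *
          (coeff8 x A * coeff8 y (sdiff A C) * coeff8 z (sdiff C D)))
        = (\<Sum>B\<in>?P. blade_sign A (sdiff A D) * blade_sign B (sdiff B (sdiff A D)) *
          (coeff8 x A * coeff8 y B * coeff8 z (sdiff B (sdiff A D))))"
      proof (rule sum.reindex_bij_witness[where i = "sdiff A" and j = "sdiff A"])
        fix C assume C: "C \<in> ?P"
        have AC: "sdiff A C \<in> ?P" using A C sdiff_subset by auto
        have E: "sdiff (sdiff A C) (sdiff A D) = sdiff C D"
          by (metis sdiff_assoc sdiff_cancel sdiff_commute)
        have D': "sdiff (sdiff A C) (sdiff C D) = sdiff A D"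
          by (metis sdiff_assoc sdiff_cancel)
        have "blade_sign A (sdiff A C) * blade_sign C (sdiff C D)
            = blade_sign A (sdiff A D) * blade_sign (sdiff A C) (sdiff C D)"
          using blade_sign_cocycle[of A "sdiff A C" "sdiff C D"] A C AC D fin
            sdiff_subset[of C "{1..8}" D] by (auto simp: D')
        then show "blade_sign A (sdiff A D) * blade_sign (sdiff A C) (sdiff (sdiff A C) (sdiff A D)) *
            (coeff8 x A * coeff8 y (sdiff A C) * coeff8 z (sdiff (sdiff A C) (sdiff A D)))
          = blade_sign A (sdiff A C) * blade_sign C (sdiff C D) *
            (coeff8 x A * coeff8 y (sdiff A C) * coeff8 z (sdiff C D))"
          by (simp add: E)
      qed (use A sdiff_subset in auto)
    qed
    also have "\<dots> = coeff8 (x * (y * z)) D"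
      by (simp add: times_cl8.rep_eq sum_distrib_left mult_ac)
    finally show "coeff8 (x * y * z) D = coeff8 (x * (y * z)) D" .
  qed
qed

end

lift_definition blade :: "nat set \<Rightarrow> cl8" is
  "\<lambda>A B. if B = A \<and> A \<subseteq> {1..8} then 1 else 0" by auto

definition cl_e :: "nat \<Rightarrow> cl8" where
  "cl_e i = blade {i}"

lemma blade_empty: "blade {} = 1"
  by transfer auto

lemma blade_mult:
  assumes "A \<subseteq> {1..8}" "B \<subseteq> {1..8}"
  shows "blade A * blade B = blade_sign A B *\<^sub>R blade (sdiff A B)"
proof (rule cl8_eqI)
  fix C :: "nat set" assume "C \<subseteq> {1..8}"
  have "coeff8 (blade A * blade B) C
      = (\<Sum>A'\<in>Pow {1..8}. if A' = A then blade_sign A B * (if C = sdiff A B then 1 else 0) else 0)"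
    unfolding times_cl8.rep_eq using assms
    by (intro sum.cong) (auto simp: blade.rep_eq sdiff_eq_iff)
  then show "coeff8 (blade A * blade B) C = coeff8 (blade_sign A B *\<^sub>R blade (sdiff A B)) C"
    using assms sdiff_subset[OF assms] by (simp add: scaleR_cl8.rep_eq blade.rep_eq)
qed

lemma coeff8_sum: "coeff8 (\<Sum>i\<in>I. f i) A = (\<Sum>i\<in>I. coeff8 (f i) A)"
  by (induction I rule: infinite_finite_induct) (auto simp: zero_cl8.rep_eq plus_cl8.rep_eq)

lemma cl8_expand: "x = (\<Sum>A\<in>Pow {1..8}. coeff8 x A *\<^sub>R blade A)"
proof (rule cl8_eqI)
  fix C :: "nat set" assume C: "C \<subseteq> {1..8}"
  have "(\<Sum>A\<in>Pow {1..8}. coeff8 (coeff8 x A *\<^sub>R blade A) C)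
      = (\<Sum>A\<in>Pow {1..8}. if A = C then coeff8 x C else 0)"
    using C by (intro sum.cong) (auto simp: scaleR_cl8.rep_eq blade.rep_eq)
  then show "coeff8 x C = coeff8 (\<Sum>A\<in>Pow {1..8}. coeff8 x A *\<^sub>R blade A) C"
    using C by (simp add: coeff8_sum)
qed

lemma blade_insert:
  assumes "m \<in> {1..8}" "A \<subseteq> {1..8}" "\<forall>a\<in>A. m < a"
  shows "blade (insert m A) = cl_e m * blade A"
proof -
  have "blade_sign {m} A = 1"
    using assms(3) by (auto simp: blade_sign_def intro!: prod.neutral)
  moreover have "sdiff {m} A = insert m A"
    using assms(3) by (auto simp: sdiff_def)
  ultimately show ?thesis
    using assms by (simp add: cl_e_def blade_mult)
qed

lemma cl_e_mult:
  assumes "i \<in> {1..8}" "j \<in> {1..8}" "i < j"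
  shows "cl_e i * cl_e j = blade {i, j}"
  using blade_insert[of i "{j}"] assms by (simp add: cl_e_def)

lemma cl_e_square: "j \<in> {1..8} \<Longrightarrow> cl_e j * cl_e j = - 1"
  by (simp add: cl_e_def blade_mult blade_empty blade_sign_def)

lemma cl_e_anticommute:
  assumes "j \<in> {1..8}" "k \<in> {1..8}" "j \<noteq> k"
  shows "cl_e j * cl_e k = - (cl_e k * cl_e j)"
  using assms by (cases "j < k") (auto simp: cl_e_def blade_mult blade_sign_def sdiff_commute)

lemma cl8_universal:
  fixes f :: "nat \<Rightarrow> 'a::real_algebra_1"
  assumes sq: "\<And>j. j \<in> {1..8} \<Longrightarrow> f j * f j = - 1"
    and anti: "\<And>j k. j \<in> {1..8} \<Longrightarrow> k \<in> {1..8} \<Longrightarrow> j \<noteq> k \<Longrightarrow> f j * f k = - (f k * f j)"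
  shows "\<exists>!h :: cl8 \<Rightarrow> 'a. linear h \<and> h 1 = 1 \<and> (\<forall>x y. h (x * y) = h x * h y) \<and>
    (\<forall>j\<in>{1..8}. h (cl_e j) = f j)"
proof -
  define F where "F A = prod_list (map f (sorted_list_of_set A))" for A
  define h where "h x = (\<Sum>A\<in>Pow {1..8}. coeff8 x A *\<^sub>R F A)" for x
  have F0: "F {} = 1" by (simp add: F_def)
  have Fins: "F (insert m A) = f m * F A" if "finite A" "\<forall>a\<in>A. m < a" for m A
  proof -
    have "m \<notin> A" using that by auto
    then have "sorted_list_of_set (insert m A) = m # sorted_list_of_set A"
      using that by (simp add: insort_is_Cons less_imp_le)
    then show ?thesis by (simp add: F_def)
  qed
  have step: "f k * F B = blade_sign {k} B *\<^sub>R F (sdiff {k} B)"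
    if "B \<subseteq> {1..8}" and k: "k \<in> {1..8}" for k B
  proof -
    have "finite B" using that finite_subset by blast
    then show ?thesis using that(1)
    proof (induction B rule: finite_linorder_min_induct)
      case empty
      then show ?case using Fins[of "{}" k] by (simp add: F0)
    next
      case (insert m B)
      have mB: "m \<notin> B" "m \<in> {1..8}" using insert by auto
      have s: "blade_sign {k} (insert m B) = (if m \<le> k then -1 else 1) * blade_sign {k} B"
        using insert mB by (simp add: blade_sign_def)
      consider "k < m" | "k = m" | "m < k" by linarith
      then show ?case
      proof cases
        case 1
        have "sdiff {k} (insert m B) = insert k (insert m B)"
          using 1 insert.hyps by (auto simp: sdiff_def)
        moreover have "blade_sign {k} (insert m B) = 1"
          using 1 insert.hyps by (auto simp: blade_sign_def intro!: prod.neutral)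
        ultimately show ?thesis
          using Fins[of "insert m B" k] 1 insert.hyps by fastforce
      next
        case 2
        have "sdiff {k} (insert m B) = B" using 2 mB by (auto simp: sdiff_def)
        moreover have "blade_sign {k} B = 1"
          using 2 insert.hyps by (auto simp: blade_sign_def intro!: prod.neutral)
        moreover have "f k * F (insert m B) = - F B"
          using 2 Fins[of B m] insert.hyps sq[OF k] by (simp flip: mult.assoc)
        ultimately show ?thesis using 2 s by simp
      next
        case 3
        have d: "sdiff {k} (insert m B) = insert m (sdiff {k} B)"
          using 3 mB by (auto simp: sdiff_def)
        have fin: "finite (sdiff {k} B)" "\<forall>a\<in>sdiff {k} B. m < a"
          using insert.hyps 3 by (auto simp: sdiff_def)
        have "f k * F (insert m B) = f k * f m * F B"
          using Fins[of B m] insert.hyps by (simp add: mult.assoc)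
        also have "\<dots> = - (f m * (f k * F B))"
          using anti[OF k mB(2)] 3 by (simp add: mult.assoc)
        also have "f k * F B = blade_sign {k} B *\<^sub>R F (sdiff {k} B)"
          using insert by auto
        finally show ?thesis
          using Fins[OF fin] 3 s by (simp add: d)
      qed
    qed
  qed
  have FF: "F A * F B = blade_sign A B *\<^sub>R F (sdiff A B)"
    if "A \<subseteq> {1..8}" and B: "B \<subseteq> {1..8}" for A B
  proof -
    have "finite A" using that finite_subset by blast
    then show ?thesis using that(1)
    proof (induction A rule: finite_linorder_min_induct)
      case empty
      then show ?case by (simp add: F0)
    next
      case (insert m A)
      have finB: "finite B" using B finite_subset by blast
      have d: "insert m A = sdiff {m} A" using insert by (auto simp: sdiff_def)
      have s: "blade_sign {m} A = 1"
        using insert.hyps by (auto simp: blade_sign_def intro!: prod.neutral)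
      have "F (insert m A) * F B = f m * (F A * F B)"
        using Fins[of A m] insert.hyps by (simp add: mult.assoc)
      also have "F A * F B = blade_sign A B *\<^sub>R F (sdiff A B)" using insert by auto
      also have "f m * \<dots> = (blade_sign A B * blade_sign {m} (sdiff A B)) *\<^sub>R F (sdiff {m} (sdiff A B))"
        using step[of "sdiff A B" m] insert.prems B sdiff_subset[of A "{1..8}" B] by auto
      also have "\<dots> = blade_sign (insert m A) B *\<^sub>R F (sdiff (insert m A) B)"
        unfolding d using blade_sign_cocycle[of "{m}" A B] insert.hyps finB
        by (simp add: s sdiff_assoc mult.commute)
      finally show ?case .
    qed
  qed
  have lin: "linear h"
    by (rule linearI) (simp_all add: h_def plus_cl8.rep_eq scaleR_cl8.rep_eq
        scaleR_add_left sum.distrib scaleR_sum_right)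
  have hb: "h (blade A) = F A" if "A \<subseteq> {1..8}" for A
  proof -
    have "h (blade A) = (\<Sum>B\<in>Pow {1..8}. if B = A then F A else 0)"
      unfolding h_def using that by (intro sum.cong) (auto simp: blade.rep_eq)
    then show ?thesis using that by simp
  qed
  have hmul: "h (x * y) = h x * h y" for x y
  proof -
    have "h (x * y) = h ((\<Sum>A\<in>Pow {1..8}. coeff8 x A *\<^sub>R blade A) *
        (\<Sum>B\<in>Pow {1..8}. coeff8 y B *\<^sub>R blade B))"
      by (intro arg_cong[where f = h] arg_cong2[where f = "(*)"] cl8_expand)
    also have "\<dots> = (\<Sum>A\<in>Pow {1..8}. \<Sum>B\<in>Pow {1..8}.
        (coeff8 x A * coeff8 y B) *\<^sub>R h (blade A * blade B))"
      by (simp add: sum_product linear_sum[OF lin] linear_scale[OF lin]) (simp only: mult.commute)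
    also have "\<dots> = (\<Sum>A\<in>Pow {1..8}. \<Sum>B\<in>Pow {1..8}. (coeff8 x A * coeff8 y B) *\<^sub>R (F A * F B))"
      by (intro sum.cong refl)
        (auto simp: blade_mult FF linear_scale[OF lin] hb sdiff_subset)
    also have "\<dots> = h x * h y"
      by (simp add: h_def sum_product mult.commute)
    finally show ?thesis .
  qed
  show ?thesis
  proof (rule ex1I[of _ h])
    have "h (cl_e j) = f j" if "j \<in> {1..8}" for j
      using that hb[of "{j}"] Fins[of "{}" j] by (simp add: cl_e_def F0)
    then show "linear h \<and> h 1 = 1 \<and> (\<forall>x y. h (x * y) = h x * h y) \<and>
        (\<forall>j\<in>{1..8}. h (cl_e j) = f j)"
      using lin hmul hb[of "{}"] by (simp add: blade_empty F0)
  next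
    fix g :: "cl8 \<Rightarrow> 'a"
    assume g: "linear g \<and> g 1 = 1 \<and> (\<forall>x y. g (x * y) = g x * g y) \<and>
        (\<forall>j\<in>{1..8}. g (cl_e j) = f j)"
    have gb: "g (blade A) = F A" if "A \<subseteq> {1..8}" for A
    proof -
      have "finite A" using that finite_subset by blast
      then show ?thesis using that
        by (induction A rule: finite_linorder_min_induct)
          (use g in \<open>auto simp: blade_empty F0 blade_insert Fins\<close>)
    qed
    show "g = h"
    proof
      fix x
      have "g x = g (\<Sum>A\<in>Pow {1..8}. coeff8 x A *\<^sub>R blade A)"
        by (intro arg_cong[where f = g] cl8_expand)
      also have "\<dots> = h x"
        using g by (simp add: linear_sum linear_scale gb h_def)
      finally show "g x = h x" .
    qed
  qed
qed

typedef spin8 = "span {cl_e i * cl_e j | i j. 1 \<le> i \<and> i < j \<and> j \<le> 8}"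
  morphisms cl8_of_spin8 Abs_spin8
  by (rule exI[of _ 0]) (rule span_zero)

setup_lifting type_definition_spin8

instantiation spin8 :: real_vector
begin

lift_definition zero_spin8 :: spin8 is 0 by (rule span_zero)
lift_definition plus_spin8 :: "spin8 \<Rightarrow> spin8 \<Rightarrow> spin8" is "(+)" by (rule span_add)
lift_definition minus_spin8 :: "spin8 \<Rightarrow> spin8 \<Rightarrow> spin8" is "(-)" by (rule span_diff)
lift_definition uminus_spin8 :: "spin8 \<Rightarrow> spin8" is uminus by (rule span_neg)
lift_definition scaleR_spin8 :: "real \<Rightarrow> spin8 \<Rightarrow> spin8" is "(*\<^sub>R)" by (rule span_scale)

instance
  by standard (transfer; simp add: algebra_simps)+

end

definition spin_e :: "nat \<Rightarrow> nat \<Rightarrow> spin8" where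
  "spin_e i j = Abs_spin8 (cl_e i * cl_e j)"

lemma cl8_of_spin_e:
  assumes "1 \<le> i" "i < j" "j \<le> 8"
  shows "cl8_of_spin8 (spin_e i j) = cl_e i * cl_e j"
  unfolding spin_e_def using assms by (intro Abs_spin8_inverse span_base) auto

lemma linear_cl8_of_spin8: "linear cl8_of_spin8"
  by (rule linearI) (simp_all add: plus_spin8.rep_eq scaleR_spin8.rep_eq)

lemma span_spin_e: "span {spin_e i j | i j. 1 \<le> i \<and> i < j \<and> j \<le> 8} = UNIV"
proof -
  let ?S = "{spin_e i j | i j. 1 \<le> i \<and> i < j \<and> j \<le> 8}"
  have "cl8_of_spin8 ` ?S = {cl_e i * cl_e j | i j. 1 \<le> i \<and> i < j \<and> j \<le> 8}"
    using cl8_of_spin_e by (auto simp: image_iff) metis+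
  then have "cl8_of_spin8 ` span ?S = range cl8_of_spin8"
    by (simp add: linear_span_image[OF linear_cl8_of_spin8, symmetric]
        type_definition.Rep_range[OF type_definition_spin8])
  then show ?thesis
    by (subst (asm) inj_image_eq_iff) (simp_all add: inj_def cl8_of_spin8_inject)
qed

text \<open>A linear endomorphism may be prescribed freely on the \<open>spin_e i j\<close> with \<open>i < j\<close>.\<close>

lemma spin8_linear_ex1:
  fixes g :: "nat \<Rightarrow> nat \<Rightarrow> spin8"
  shows "\<exists>!f :: spin8 \<Rightarrow> spin8. linear f \<and>
    (\<forall>i j. 1 \<le> i \<longrightarrow> i < j \<longrightarrow> j \<le> 8 \<longrightarrow> f (spin_e i j) = g i j)"
proof -
  define I :: "(nat \<times> nat) set" where "I = {p \<in> {1..8} \<times> {1..8}. fst p < snd p}"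
  have finI: "finite I" by (simp add: I_def)
  define f where
    "f x = (\<Sum>p\<in>I. coeff8 (cl8_of_spin8 x) {fst p, snd p} *\<^sub>R g (fst p) (snd p))" for x
  have lin: "linear f"
    by (rule linearI) (simp_all add: f_def plus_spin8.rep_eq scaleR_spin8.rep_eq plus_cl8.rep_eq
        scaleR_cl8.rep_eq scaleR_add_left sum.distrib scaleR_sum_right)
  have val: "f (spin_e i j) = g i j" if ij: "1 \<le> i" "i < j" "j \<le> 8" for i j
  proof -
    have "f (spin_e i j) = (\<Sum>p\<in>I. if p = (i, j) then g i j else 0)"
      unfolding f_def using ij
      by (intro sum.cong) (auto simp: cl8_of_spin_e cl_e_mult blade.rep_eq I_def doubleton_eq_iff)
    then show ?thesis using finI ij by (simp add: I_def)
  qed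
  show ?thesis
  proof (rule ex1I[of _ f])
    show "linear f \<and> (\<forall>i j. 1 \<le> i \<longrightarrow> i < j \<longrightarrow> j \<le> 8 \<longrightarrow> f (spin_e i j) = g i j)"
      using lin val by blast
  next
    fix f' assume f': "linear f' \<and> (\<forall>i j. 1 \<le> i \<longrightarrow> i < j \<longrightarrow> j \<le> 8 \<longrightarrow> f' (spin_e i j) = g i j)"
    have "f' x = f x" for x
    proof (rule linear_eq_on_span[where f = f' and g = f])
      show "linear f'" "linear f" using f' lin by blast+
      show "x \<in> span {spin_e i j | i j. 1 \<le> i \<and> i < j \<and> j \<le> 8}"
        by (simp only: span_spin_e UNIV_I)
    qed (use f' val in auto)
    then show "f' = f" by auto
  qed
qed

text \<open>\<open>spin_t i j\<close> is meant for \<open>1 \<le> i < j \<le> 8\<close> only; it is unspecified elsewhere.\<close>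

definition spin_t :: "nat \<Rightarrow> nat \<Rightarrow> spin8" where
  "spin_t i j = the (map_of
    [((1, 2), spin_e 1 2 + spin_e 3 4 + spin_e 5 6 + spin_e 7 8),
     ((1, 3), spin_e 1 3 - spin_e 2 4 + spin_e 5 7 - spin_e 6 8),
     ((1, 4), spin_e 1 4 + spin_e 2 3 - spin_e 5 8 - spin_e 6 7),
     ((1, 5), spin_e 1 5 - spin_e 2 6 - spin_e 3 7 + spin_e 4 8),
     ((1, 6), spin_e 1 6 + spin_e 2 5 + spin_e 3 8 + spin_e 4 7),
     ((1, 7), spin_e 1 7 - spin_e 2 8 + spin_e 3 5 - spin_e 4 6),
     ((1, 8), spin_e 1 8 + spin_e 2 7 - spin_e 3 6 - spin_e 4 5),
     ((2, 3), spin_e 1 4 + spin_e 2 3 + spin_e 5 8 + spin_e 6 7),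
     ((2, 4), - spin_e 1 3 + spin_e 2 4 + spin_e 5 7 - spin_e 6 8),
     ((2, 5), spin_e 1 6 + spin_e 2 5 - spin_e 3 8 - spin_e 4 7),
     ((2, 6), - spin_e 1 5 + spin_e 2 6 - spin_e 3 7 + spin_e 4 8),
     ((2, 7), spin_e 1 8 + spin_e 2 7 + spin_e 3 6 + spin_e 4 5),
     ((2, 8), - spin_e 1 7 + spin_e 2 8 + spin_e 3 5 - spin_e 4 6),
     ((3, 4), spin_e 1 2 + spin_e 3 4 - spin_e 5 6 - spin_e 7 8),
     ((3, 5), spin_e 1 7 + spin_e 2 8 + spin_e 3 5 + spin_e 4 6),
     ((3, 6), - spin_e 1 8 + spin_e 2 7 + spin_e 3 6 - spin_e 4 5),
     ((3, 7), - spin_e 1 5 - spin_e 2 6 + spin_e 3 7 + spin_e 4 8),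
     ((3, 8), spin_e 1 6 - spin_e 2 5 + spin_e 3 8 - spin_e 4 7),
     ((4, 5), - spin_e 1 8 + spin_e 2 7 - spin_e 3 6 + spin_e 4 5),
     ((4, 6), - spin_e 1 7 - spin_e 2 8 + spin_e 3 5 + spin_e 4 6),
     ((4, 7), spin_e 1 6 - spin_e 2 5 - spin_e 3 8 + spin_e 4 7),
     ((4, 8), spin_e 1 5 + spin_e 2 6 + spin_e 3 7 + spin_e 4 8),
     ((5, 6), spin_e 1 2 - spin_e 3 4 + spin_e 5 6 - spin_e 7 8),
     ((5, 7), spin_e 1 3 + spin_e 2 4 + spin_e 5 7 + spin_e 6 8),
     ((5, 8), - spin_e 1 4 + spin_e 2 3 + spin_e 5 8 - spin_e 6 7),
     ((6, 7), - spin_e 1 4 + spin_e 2 3 - spin_e 5 8 + spin_e 6 7),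
     ((6, 8), - spin_e 1 3 - spin_e 2 4 + spin_e 5 7 + spin_e 6 8),
     ((7, 8), spin_e 1 2 - spin_e 3 4 - spin_e 5 6 + spin_e 7 8)] (i, j))"

definition tau_star :: "spin8 \<Rightarrow> spin8" where
  "tau_star = (THE f. linear f \<and>
    (\<forall>i j. 1 \<le> i \<longrightarrow> i < j \<longrightarrow> j \<le> 8 \<longrightarrow> f (spin_e i j) = (1/2) *\<^sub>R spin_t i j))"

definition sigma_star :: "spin8 \<Rightarrow> spin8" where
  "sigma_star = (THE f. linear f \<and>
    (\<forall>i j. 1 \<le> i \<longrightarrow> i < j \<longrightarrow> j \<le> 8 \<longrightarrow>
      f (spin_e i j) = (if i = 1 then - (1/2) else 1/2) *\<^sub>R spin_t i j))"

lemma tau_star: "linear tau_star"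
    "\<And>i j. 1 \<le> i \<Longrightarrow> i < j \<Longrightarrow> j \<le> 8 \<Longrightarrow> tau_star (spin_e i j) = (1/2) *\<^sub>R spin_t i j"
  using theI'[OF spin8_linear_ex1[of "\<lambda>i j. (1/2) *\<^sub>R spin_t i j"], folded tau_star_def] by blast+

lemma sigma_star: "linear sigma_star"
    "\<And>k. 2 \<le> k \<Longrightarrow> k \<le> 8 \<Longrightarrow> sigma_star (spin_e 1 k) = - (1/2) *\<^sub>R spin_t 1 k"
    "\<And>i j. 2 \<le> i \<Longrightarrow> i < j \<Longrightarrow> j \<le> 8 \<Longrightarrow> sigma_star (spin_e i j) = (1/2) *\<^sub>R spin_t i j"
proof -
  have *: "linear sigma_star \<and> (\<forall>i j. 1 \<le> i \<longrightarrow> i < j \<longrightarrow> j \<le> 8 \<longrightarrow>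
      sigma_star (spin_e i j) = (if i = 1 then - (1/2) else 1/2) *\<^sub>R spin_t i j)"
    using theI'[OF spin8_linear_ex1[of "\<lambda>i j. (if i = 1 then - (1/2) else 1/2) *\<^sub>R spin_t i j"],
        folded sigma_star_def] .
  then show "linear sigma_star" by blast
  show "sigma_star (spin_e 1 k) = - (1/2) *\<^sub>R spin_t 1 k" if "2 \<le> k" "k \<le> 8" for k
    using conjunct2[OF *, rule_format, of 1 k] that by simp
  show "sigma_star (spin_e i j) = (1/2) *\<^sub>R spin_t i j" if "2 \<le> i" "i < j" "j \<le> 8" for i j
    using conjunct2[OF *, rule_format, of i j] that by simp
qed

definition End_spin8 :: "(spin8 \<Rightarrow> spin8) monoid" where
  "End_spin8 = \<lparr>carrier = {f. linear f}, mult = (\<circ>), one = id\<rparr>"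

lemma monoid_End_spin8: "monoid End_spin8"
  by (rule monoidI) (auto simp: End_spin8_def linear_compose linear_id[unfolded id_def] id_def)

definition GL_spin8 :: "(spin8 \<Rightarrow> spin8) monoid" where
  "GL_spin8 = units_of End_spin8"

end

theory Submission
  imports Defs
begin

text \<open>
  The 28 basis vectors \<open>spin_e i j\<close> fall into seven blocks of four, one for each \<open>k\<close> from 2 to 8:
  \<open>spin_e 1 k\<close> and the three basis vectors that occur with it in \<open>spin_t 1 k\<close>. Both endomorphisms
  preserve the span of every block. Regard the basis as orthonormal. On the block of \<open>k\<close>,
  \<open>tau_star\<close> is half of a symmetric Hadamard matrix with trace 4, and it is the reflection
  in the hyperplane orthogonal to the unit vector \<open>u = spin_e 1 k - tau_star (spin_e 1 k)\<close>.
  The map \<open>flip_first = tau_star \<circ> sigma_star\<close> negates \<open>spin_e 1 k\<close> and fixes the other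
  three vectors, so it is the reflection in the hyperplane orthogonal to \<open>spin_e 1 k\<close>. The inner
  product of \<open>u\<close> and \<open>spin_e 1 k\<close> is 1/2 in every block: the two normals enclose an angle of 60
  degrees, and \<open>sigma_star = tau_star \<circ> flip_first\<close> rotates their plane by 120 degrees. Two reflections
  at this angle generate the symmetry group of an equilateral triangle, which is \<open>S\<^sub>3\<close>.

  Algebraically this is the Coxeter presentation of \<open>S\<^sub>3\<close>: both reflections are involutions
  (\<open>tau_star_tau_star\<close>, \<open>flip_first_flip_first\<close>), and they satisfy the braid relation
  (\<open>tau_star_flip_first_braid\<close>), which expresses the angle. Hence \<open>sigma_star\<close> has order three
  and \<open>tau_star\<close> conjugates it to its square. A group-theoretic lemma (\<open>dihedral_word_iso\<close>) says that these
  relations, together with \<open>sigma_star \<noteq> id\<close>, determine the generated group up to isomorphism.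
  It also applies to a three-cycle and a transposition in \<open>sym_group 3\<close>, and comparing the
  two cases gives the isomorphism.
\<close>

section \<open>The two reflections of spin(8)\<close>

lemma spin8_linear_eqI:
  assumes "linear f" "linear g"
    and "\<And>i j. 1 \<le> i \<Longrightarrow> i < j \<Longrightarrow> j \<le> 8 \<Longrightarrow> f (spin_e i j) = g (spin_e i j)"
  shows "f = (g :: spin8 \<Rightarrow> spin8)"
proof
  fix x
  have "x \<in> span {spin_e i j | i j. 1 \<le> i \<and> i < j \<and> j \<le> 8}"
    by (simp only: span_spin_e UNIV_I)
  then show "f x = g x"
    by (rule linear_eq_on_span[OF assms(1,2), rotated]) (use assms(3) in auto)
qed

lemma index_pair_cases:
  assumes "1 \<le> i" "i < j" "j \<le> (8 :: nat)"
  shows "(i, j) \<in> {(1,2), (1,3), (1,4), (1,5), (1,6), (1,7), (1,8),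
    (2,3), (2,4), (2,5), (2,6), (2,7), (2,8), (3,4), (3,5), (3,6), (3,7), (3,8),
    (4,5), (4,6), (4,7), (4,8), (5,6), (5,7), (5,8), (6,7), (6,8), (7,8)}"
proof -
  have "i \<in> {1, 2, 3, 4, 5, 6, 7}" and "j \<in> {2, 3, 4, 5, 6, 7, 8}"
    using assms by auto
  with \<open>i < j\<close> show ?thesis
    by (elim insertE emptyE) simp_all
qed

text \<open>
  The doubled map sends basis vectors to combinations with coefficients \<open>\<plusminus>1\<close>, so identities between
  its composites on the basis are cancellations in an abelian group, without scalars.
\<close>

definition tau_double :: "spin8 \<Rightarrow> spin8" where
  "tau_double x = 2 *\<^sub>R tau_star x"

lemma linear_tau_double: "linear tau_double"
  unfolding tau_double_def by (rule linear_compose_scale_right[OF tau_star(1)])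

lemma tau_star_eq: "tau_star x = (1/2) *\<^sub>R tau_double x"
  by (simp add: tau_double_def)

lemma tau_double_spin_e:
  assumes "1 \<le> i" "i < j" "j \<le> 8"
  shows "tau_double (spin_e i j) = spin_t i j"
  using assms by (simp add: tau_double_def tau_star(2))

lemmas tau_double_simps =
  linear_add[OF linear_tau_double] linear_diff[OF linear_tau_double]
  linear_neg[OF linear_tau_double] tau_double_spin_e spin_t_def

text \<open>
  On each block the matrix \<open>H\<close> of \<open>tau_double\<close> is a symmetric Hadamard matrix of order four,
  so \<open>H\<^sup>2 = 4\<close>.
\<close>

lemma tau_star_tau_star: "tau_star \<circ> tau_star = id"
proof (rule spin8_linear_eqI)
  fix i j :: nat assume ij: "1 \<le> i" "i < j" "j \<le> 8"
  have "tau_double (tau_double (spin_e i j)) = spin_e i j + spin_e i j + spin_e i j + spin_e i j"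
    using index_pair_cases[OF ij] by (elim insertE emptyE) (simp_all add: tau_double_simps)
  also have "\<dots> = 4 *\<^sub>R spin_e i j"
    by (simp add: scaleR_left_distrib[of 2 2, simplified] scaleR_2 add.assoc)
  finally show "(tau_star \<circ> tau_star) (spin_e i j) = id (spin_e i j)"
    by (simp add: tau_star_eq linear_scale[OF linear_tau_double])
qed (simp_all add: linear_compose tau_star(1) linear_id)

definition flip_first :: "spin8 \<Rightarrow> spin8" where
  "flip_first = tau_star \<circ> sigma_star"

lemma linear_flip_first: "linear flip_first"
  unfolding flip_first_def by (rule linear_compose[OF sigma_star(1) tau_star(1)])

text \<open>
  This is the action on bivectors of the reflection of \<open>\<real>\<^sup>8\<close> that negates the first coordinate:
  \<open>sigma_star\<close> and \<open>tau_star\<close> differ exactly by the sign on the \<open>spin_e 1 k\<close>.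
\<close>

lemma flip_first_spin_e:
  assumes ij: "1 \<le> i" "i < j" "j \<le> 8"
  shows "flip_first (spin_e i j) = (if i = 1 then - spin_e i j else spin_e i j)"
proof -
  have "sigma_star (spin_e i j) = (if i = 1 then - tau_star (spin_e i j) else tau_star (spin_e i j))"
  proof (cases "i = 1")
    case True
    then show ?thesis using ij sigma_star(2)[of j] tau_star(2)[of 1 j] by simp
  next
    case False
    then show ?thesis using ij by (simp add: sigma_star(3) tau_star(2))
  qed
  moreover have "tau_star (tau_star (spin_e i j)) = spin_e i j"
    using fun_cong[OF tau_star_tau_star, of "spin_e i j"] by simp
  ultimately show ?thesis
    by (auto simp: flip_first_def linear_neg[OF tau_star(1)])
qed

lemma sigma_star_eq: "sigma_star = tau_star \<circ> flip_first"
  by (metis comp_assoc flip_first_def id_comp tau_star_tau_star)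

lemma flip_first_flip_first: "flip_first \<circ> flip_first = id"
  by (rule spin8_linear_eqI)
    (simp_all add: linear_compose linear_flip_first linear_id flip_first_spin_e
      linear_neg[OF linear_flip_first])

lemmas flip_first_simps =
  linear_add[OF linear_flip_first] linear_diff[OF linear_flip_first]
  linear_neg[OF linear_flip_first] flip_first_spin_e

text \<open>
  Two reflections satisfy the braid relation when their normals enclose 60 degrees. The left side
  applies \<open>tau_star\<close> twice and the right side once, so replacing \<open>tau_star\<close> by \<open>tau_double\<close>
  multiplies them by 4 and by 2: hence the sum of two equal terms below.
\<close>

lemma tau_star_flip_first_braid:
  "tau_star \<circ> flip_first \<circ> tau_star = flip_first \<circ> tau_star \<circ> flip_first"
proof (rule spin8_linear_eqI)
  fix i j :: nat assume ij: "1 \<le> i" "i < j" "j \<le> 8"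
  define y where "y = flip_first (tau_double (flip_first (spin_e i j)))"
  have "tau_double (flip_first (tau_double (spin_e i j))) = y + y"
    unfolding y_def using index_pair_cases[OF ij]
    by (elim insertE emptyE) (simp_all add: tau_double_simps flip_first_simps)
  then show "(tau_star \<circ> flip_first \<circ> tau_star) (spin_e i j)
      = (flip_first \<circ> tau_star \<circ> flip_first) (spin_e i j)"
    by (simp add: y_def tau_star_eq linear_scale[OF linear_tau_double]
        linear_scale[OF linear_flip_first] flip: scaleR_2)
qed (intro linear_compose tau_star(1) linear_flip_first)+

section \<open>The relations between sigma and tau\<close>

lemma sigma_star_cube: "sigma_star \<circ> sigma_star \<circ> sigma_star = id"
proof -
  have "sigma_star \<circ> sigma_star \<circ> sigma_star
      = (tau_star \<circ> flip_first \<circ> tau_star) \<circ> (flip_first \<circ> tau_star \<circ> flip_first)"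
    by (simp add: sigma_star_eq comp_assoc)
  also have "\<dots> = flip_first \<circ> tau_star \<circ> (flip_first \<circ> flip_first) \<circ> tau_star \<circ> flip_first"
    unfolding tau_star_flip_first_braid by (simp only: comp_assoc)
  also have "\<dots> = flip_first \<circ> (tau_star \<circ> tau_star) \<circ> flip_first"
    by (simp add: flip_first_flip_first comp_assoc)
  finally show ?thesis
    by (simp add: tau_star_tau_star flip_first_flip_first)
qed

lemma tau_star_sigma_star: "tau_star \<circ> sigma_star = sigma_star \<circ> sigma_star \<circ> tau_star"
proof -
  have "sigma_star \<circ> sigma_star \<circ> tau_star
      = tau_star \<circ> (flip_first \<circ> tau_star \<circ> flip_first) \<circ> tau_star"
    by (simp add: sigma_star_eq comp_assoc)
  also have "\<dots> = (tau_star \<circ> tau_star) \<circ> flip_first \<circ> (tau_star \<circ> tau_star)"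
    unfolding tau_star_flip_first_braid[symmetric] by (simp only: comp_assoc)
  finally show ?thesis
    by (simp add: tau_star_tau_star flip_first_def)
qed

text \<open>
  The vector \<open>sigma_star (spin_e 1 2)\<close> has coefficient \<open>-1/2\<close> at \<open>spin_e 3 4\<close>, which is the blade of
  \<open>{3, 4}\<close>.
\<close>

lemma sigma_star_neq_id: "sigma_star \<noteq> id"
proof
  assume "sigma_star = id"
  then have "coeff8 (cl8_of_spin8 (sigma_star (spin_e 1 2))) {3, 4}
      = coeff8 (cl8_of_spin8 (spin_e 1 2)) {3, 4}"
    by simp
  then show False
    using sigma_star(2)[of 2]
    by (simp add: spin_t_def scaleR_spin8.rep_eq plus_spin8.rep_eq cl8_of_spin_e
        scaleR_cl8.rep_eq plus_cl8.rep_eq uminus_spin8.rep_eq uminus_cl8.rep_eq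
        cl_e_mult blade.rep_eq doubleton_eq_iff)
qed

section \<open>Groups generated by a rotation of order three and a reflection\<close>

text \<open>
  The pair \<open>(i, a)\<close> stands for \<open>r\<^sup>i\<close> if \<open>a\<close> is false and for \<open>r\<^sup>i s\<close> if \<open>a\<close> is true. The product is dictated
  by \<open>s r\<^sup>k = r\<^sup>2\<^sup>k s\<close>: moving \<open>s\<close> to the right doubles the exponent that it passes.
\<close>

definition dihedral6 :: "(nat \<times> bool) monoid" where
  "dihedral6 = \<lparr>carrier = {0, 1, 2} \<times> UNIV,
     mult = (\<lambda>(i, a) (k, b). ((i + (if a then 2 * k else k)) mod 3, a \<noteq> b)),
     one = (0, False)\<rparr>"

lemma group_dihedral6: "group dihedral6"
proof (rule groupI)
  fix x assume "x \<in> carrier dihedral6"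
  \<comment> \<open>Reflections are their own inverses; the inverse of \<open>r\<^sup>i\<close> is \<open>r\<^sup>2\<^sup>i\<close>.\<close>
  then have "(if snd x then x else ((2 * fst x) mod 3, False)) \<in> carrier dihedral6"
    "(if snd x then x else ((2 * fst x) mod 3, False)) \<otimes>\<^bsub>dihedral6\<^esub> x = \<one>\<^bsub>dihedral6\<^esub>"
    by (auto simp: dihedral6_def)
  then show "\<exists>y\<in>carrier dihedral6. y \<otimes>\<^bsub>dihedral6\<^esub> x = \<one>\<^bsub>dihedral6\<^esub>" by blast
qed (auto simp: dihedral6_def split: if_splits)

definition dihedral_word :: "('a, 'b) monoid_scheme \<Rightarrow> 'a \<Rightarrow> 'a \<Rightarrow> nat \<times> bool \<Rightarrow> 'a" where
  "dihedral_word G r s = (\<lambda>(i, a). r [^]\<^bsub>G\<^esub> i \<otimes>\<^bsub>G\<^esub> (if a then s else \<one>\<^bsub>G\<^esub>))"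

text \<open>
  The relations bring every word in \<open>r\<close> and \<open>s\<close> into one of the six normal forms, so the map from the
  model is a surjective homomorphism onto the generated group. Its kernel is trivial as soon as
  \<open>r \<noteq> \<one>\<close>: if \<open>r\<^sup>i s\<close> were the identity, then \<open>s\<close> would commute with \<open>r\<close>, and
  \<open>s r = r\<^sup>2 s\<close> would force \<open>r = \<one>\<close>.
\<close>

lemma (in group) dihedral_word_iso:
  assumes r: "r \<in> carrier G" and s: "s \<in> carrier G"
    and cube: "r \<otimes> r \<otimes> r = \<one>" and "r \<noteq> \<one>" and square: "s \<otimes> s = \<one>"
    and rel: "s \<otimes> r = r \<otimes> r \<otimes> s"
  shows "dihedral_word G r s \<in> iso dihedral6 (G\<lparr>carrier := generate G {r, s}\<rparr>)"
proof -
  let ?w = "dihedral_word G r s"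
  have pow_mod: "r [^] (n mod 3) = r [^] n" for n :: nat
  proof -
    have "r [^] (3 :: nat) = \<one>" using r cube by (simp add: numeral_3_eq_3)
    then have "r [^] (3 * (n div 3)) = \<one>"
      using nat_pow_pow[OF r, of 3 "n div 3"] by simp
    moreover have "r [^] n = r [^] (3 * (n div 3)) \<otimes> r [^] (n mod 3)"
      by (subst nat_pow_mult[OF r]) simp
    ultimately show ?thesis using r by simp
  qed
  have s_pow: "s \<otimes> r [^] k = r [^] (2 * k) \<otimes> s" for k :: nat
  proof (induction k)
    case 0
    then show ?case using s by simp
  next
    case (Suc k)
    have "s \<otimes> r [^] Suc k = s \<otimes> r [^] k \<otimes> r" using r s by (simp add: m_assoc)
    also have "\<dots> = r [^] (2 * k) \<otimes> (s \<otimes> r)" using r s Suc by (simp add: m_assoc)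
    also have "\<dots> = r [^] (2 * Suc k) \<otimes> s" using r s by (simp add: rel m_assoc)
    finally show ?case .
  qed
  have mult: "?w (x \<otimes>\<^bsub>dihedral6\<^esub> y) = ?w x \<otimes> ?w y" for x y
  proof (cases x; cases y)
    fix i a k b assume [simp]: "x = (i, a)" "y = (k, b)"
    have "r [^] i \<otimes> s \<otimes> (r [^] k \<otimes> z) = r [^] (i + 2 * k) \<otimes> (s \<otimes> z)"
      if "z \<in> carrier G" for z
    proof -
      have "r [^] i \<otimes> s \<otimes> (r [^] k \<otimes> z) = r [^] i \<otimes> (s \<otimes> r [^] k) \<otimes> z"
        using r s that by (simp add: m_assoc)
      then show ?thesis
        using r s that by (simp add: s_pow m_assoc flip: nat_pow_mult)
    qed
    then show ?thesis
      using r s square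
      by (simp add: dihedral_word_def dihedral6_def pow_mod m_assoc flip: nat_pow_mult)
  qed
  have in_gen: "?w x \<in> generate G {r, s}" for x
  proof -
    have "r [^] i \<in> generate G {r, s}" for i :: nat
      by (induction i) (auto intro: generate.intros)
    then show ?thesis
      by (auto simp: dihedral_word_def split: prod.split intro: generate.intros)
  qed
  have gen: "generate G {r, s} = ?w ` carrier dihedral6"
  proof
    show "generate G {r, s} \<subseteq> ?w ` carrier dihedral6"
    proof
      fix x assume "x \<in> generate G {r, s}"
      then show "x \<in> ?w ` carrier dihedral6"
      proof (induction rule: generate.induct)
        case one
        then show ?case
          by (intro image_eqI[of _ _ "(0, False)"]) (auto simp: dihedral_word_def dihedral6_def)
      next
        case (incl h)
        then show ?case using r s
          by (intro image_eqI[of _ _ "if h = r then (1, False) else (0, True)"])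
            (auto simp: dihedral_word_def dihedral6_def)
      next
        case (inv h)
        have "inv r = r \<otimes> r" "inv s = s" using r s cube square by (auto intro: inv_equality)
        with inv show ?case using r s
          by (intro image_eqI[of _ _ "if h = r then (2, False) else (0, True)"])
            (auto simp: dihedral_word_def dihedral6_def numeral_2_eq_2)
      next
        case (eng h1 h2)
        then obtain x y where "x \<in> carrier dihedral6" "h1 = ?w x" "y \<in> carrier dihedral6" "h2 = ?w y"
          by blast
        moreover have "x \<otimes>\<^bsub>dihedral6\<^esub> y \<in> carrier dihedral6"
          using calculation group.is_monoid[OF group_dihedral6] by (simp add: monoid.m_closed)
        ultimately show ?case by (metis mult image_eqI)
      qed
    qed
  qed (use in_gen in auto)
  have s_neq: "r [^] i \<otimes> s \<noteq> \<one>" for i :: nat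
  proof
    assume "r [^] i \<otimes> s = \<one>"
    then have "s = inv (r [^] i)"
      using r s by (metis inv_equality inv_inv nat_pow_closed)
    moreover have "r [^] i \<otimes> r = r \<otimes> r [^] i" using r by (metis nat_pow_Suc nat_pow_Suc2)
    ultimately have "s \<otimes> r = r \<otimes> s"
      using r by (metis inv_closed inv_solve_left inv_solve_right m_assoc m_closed nat_pow_closed)
    with rel have "r \<otimes> s = r \<otimes> (r \<otimes> s)" using r s by (simp add: m_assoc)
    with r s \<open>r \<noteq> \<one>\<close> show False by (metis l_cancel_one' m_closed r_cancel_one' m_assoc)
  qed
  have "r \<otimes> r \<noteq> \<one>" using cube r \<open>r \<noteq> \<one>\<close> by auto
  then have trivial_kernel: "x = \<one>\<^bsub>dihedral6\<^esub>" if "x \<in> carrier dihedral6" "?w x = \<one>" for x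
    using that s_neq[of 0] s_neq[of 1] s_neq[of 2] r s \<open>r \<noteq> \<one>\<close>
    by (auto simp: dihedral_word_def dihedral6_def numeral_2_eq_2 split: if_splits)
  have "?w \<in> hom dihedral6 G"
    using mult in_gen generate_in_carrier[of "{r, s}"] r s by (intro homI) auto
  then interpret hom: group_hom dihedral6 G ?w
    by (intro group_hom.intro group_hom_axioms.intro group_dihedral6 is_group)
  have "inj_on ?w (carrier dihedral6)"
    using trivial_kernel by (simp add: hom.inj_on_one_iff)
  then show ?thesis
    using mult in_gen by (intro isoI homI) (auto simp: bij_betw_def gen)
qed

text \<open>
  The three-cycle \<open>1 \<mapsto> 2 \<mapsto> 3 \<mapsto> 1\<close> and the transposition of 1 and 2 satisfy the relations, so they
  generate a subgroup of order six, which must be the whole group since \<open>3! = 6\<close>.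
\<close>

lemma sym_group_3_words:
  "dihedral_word (sym_group 3) (transpose 1 2 \<circ> transpose 2 3) (transpose 1 2)
    \<in> iso dihedral6 (sym_group 3)"
proof -
  let ?r = "transpose 1 2 \<circ> transpose 2 (3 :: nat)" and ?s = "transpose 1 (2 :: nat)"
  let ?H = "generate (sym_group 3) {?r, ?s}"
  interpret S: group "sym_group 3" by (rule sym_group_is_group)
  have mem: "?r \<in> carrier (sym_group 3)" "?s \<in> carrier (sym_group 3)"
    by (auto simp: sym_group_def intro!: permutes_compose permutes_swap_id)
  have iso: "dihedral_word (sym_group 3) ?r ?s \<in> iso dihedral6 (sym_group 3\<lparr>carrier := ?H\<rparr>)"
    using mem
  proof (rule S.dihedral_word_iso)
    show "?r \<noteq> \<one>\<^bsub>sym_group 3\<^esub>"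
      by (auto simp: sym_group_def fun_eq_iff transpose_def intro!: exI[of _ 1])
  qed (auto simp: sym_group_def fun_eq_iff transpose_def)
  then have "card ?H = card (carrier dihedral6)"
    by (auto simp: iso_def dest: bij_betw_same_card)
  then have "card ?H = card (carrier (sym_group 3))"
    by (simp add: dihedral6_def sym_group_card_carrier card_cartesian_product fact_numeral)
  moreover have "finite (carrier (sym_group 3))"
    by (simp add: sym_group_def finite_permutations)
  ultimately have "?H = carrier (sym_group 3)"
    using S.generate_incl[of "{?r, ?s}"] mem by (intro card_subset_eq) auto
  with iso show ?thesis by simp
qed

section \<open>The group generated by sigma and tau\<close>

theorem corollary4p1:
  shows "sigma_star \<in> carrier GL_spin8 \<and> tau_star \<in> carrier GL_spin8 \<and>
    GL_spin8\<lparr>carrier := generate GL_spin8 {sigma_star, tau_star}\<rparr> \<cong> sym_group 3"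
proof -
  have "linear (sigma_star \<circ> sigma_star)" by (intro linear_compose sigma_star(1))
  moreover have "sigma_star \<circ> (sigma_star \<circ> sigma_star) = id"
    using sigma_star_cube by (simp add: comp_assoc)
  ultimately have sigma: "sigma_star \<in> carrier GL_spin8"
    using sigma_star(1) sigma_star_cube
    by (auto simp: GL_spin8_def End_spin8_def units_of_def Units_def)
  have tau: "tau_star \<in> carrier GL_spin8"
    using tau_star(1) tau_star_tau_star
    by (auto simp: GL_spin8_def End_spin8_def units_of_def Units_def)
  have ops: "mult GL_spin8 = (\<circ>)" "one GL_spin8 = id"
    by (simp_all add: GL_spin8_def units_of_def End_spin8_def)
  interpret GL: group GL_spin8
    unfolding GL_spin8_def by (rule monoid.units_group[OF monoid_End_spin8])
  have "dihedral_word GL_spin8 sigma_star tau_star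
      \<in> iso dihedral6 (GL_spin8\<lparr>carrier := generate GL_spin8 {sigma_star, tau_star}\<rparr>)"
    using sigma tau
    by (rule GL.dihedral_word_iso)
      (simp_all only: ops sigma_star_cube sigma_star_neq_id tau_star_tau_star tau_star_sigma_star
        not_False_eq_True)
  then have "dihedral6 \<cong> GL_spin8\<lparr>carrier := generate GL_spin8 {sigma_star, tau_star}\<rparr>"
    by (rule is_isoI)
  then have "GL_spin8\<lparr>carrier := generate GL_spin8 {sigma_star, tau_star}\<rparr> \<cong> dihedral6"
    by (rule group.iso_sym[OF group_dihedral6])
  also have "dihedral6 \<cong> sym_group 3"
    using sym_group_3_words by (rule is_isoI)
  finally show ?thesis using sigma tau by blast
qed

end
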